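(* For every $n\geq 2$, $\kappa(BH_n;K_{1,1})=2n$.
   Context: The $n$-dimensional balanced hypercube $BH_n$ is the graph with vertex set $\{0,1,2,3\}^n$, vertices written $(a_0,a_1,\dots,a_{n-1})$, in which $(a_0,\dots,a_{n-1})$ is adjacent exactly to the $2n$ vertices $((a_0\pm 1)\bmod 4,a_1,\dots,a_{n-1})$ and, for each $1\le i\le n-1$, $((a_0\pm1)\bmod 4,a_1,\dots,a_{i-1},(a_i+(-1)^{a_0})\bmod 4,a_{i+1},\dots,a_{n-1})$. For a connected graph $G$ and a set $F$ of connected subgraphs of $G$, let $V(F)$ be the union of their vertex sets; $F$ is a subgraph-cut if $G-V(F)$ is disconnected or trivial. For a connected subgraph $H$ of $G$, an $H$-structure-cut is a subgraph-cut each of whose elements is isomorphic to $H$, and $\kappa(G;H)$ is the minimum cardinality of an $H$-structure-cut. $K_{1,1}$ is the graph consisting of a single edge. *)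

theory Defs
  imports "Graph_Theory.Graph_Theory"
begin

text \<open>
  Undirected simple graphs are represented, as usual in this library, by symmetric loop-free
  digraphs without parallel arcs (locale \<^locale>\<open>graph\<close>): the edge \<open>uv\<close> is the pair of arcs
  \<open>(u,v)\<close>, \<open>(v,u)\<close>.
\<close>

text \<open>
  The balanced hypercube; a vertex \<open>(a\<^sub>0, \<dots>, a\<^sub>n\<^sub>-\<^sub>1)\<close> is a list of length \<open>n\<close>. It is meaningful
  for \<open>n \<ge> 1\<close> only.
\<close>

definition bh_verts :: "nat \<Rightarrow> int list set" where
  "bh_verts n = {a. length a = n \<and> set a \<subseteq> {0, 1, 2, 3}}"

definition bh_neighbours :: "nat \<Rightarrow> int list \<Rightarrow> int list set" where
  "bh_neighbours n a =
     {a[0 := (a ! 0 + s) mod 4] | s. s \<in> {1, -1}} \<union>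
     {a[0 := (a ! 0 + s) mod 4, i := (a ! i + (-1) ^ nat (a ! 0)) mod 4] | s i.
        s \<in> {1, -1} \<and> 1 \<le> i \<and> i \<le> n - 1}"

definition BH :: "nat \<Rightarrow> int list pair_pre_digraph" where
  "BH n = \<lparr> pverts = bh_verts n, parcs = {(a, b). a \<in> bh_verts n \<and> b \<in> bh_neighbours n a} \<rparr>"

definition K11 :: "nat pair_pre_digraph" where
  "K11 = \<lparr> pverts = {0, 1}, parcs = {(0, 1), (1, 0)} \<rparr>"

definition connected_subgraph :: "('a, 'b) pre_digraph \<Rightarrow> ('a, 'b) pre_digraph \<Rightarrow> bool" where
  "connected_subgraph S G \<longleftrightarrow> subgraph S G \<and> graph S \<and> connected S"

definition trivial_graph :: "('a, 'b) pre_digraph \<Rightarrow> bool" where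
  "trivial_graph G \<longleftrightarrow> card (verts G) = 1"

definition verts_of :: "('a, 'b) pre_digraph set \<Rightarrow> 'a set" where
  "verts_of F = (\<Union>S\<in>F. verts S)"

definition delete_verts :: "('a, 'b) pre_digraph \<Rightarrow> 'a set \<Rightarrow> ('a, 'b) pre_digraph" where
  "delete_verts G X = G \<restriction> (verts G - X)"

text \<open>
  The library's \<^const>\<open>connected\<close> is false for the graph without vertices, so a family covering
  all vertices of \<open>G\<close> counts as a cut.
\<close>

definition subgraph_cut :: "('a, 'b) pre_digraph \<Rightarrow> ('a, 'b) pre_digraph set \<Rightarrow> bool" where
  "subgraph_cut G F \<longleftrightarrow>
     (\<forall>S\<in>F. connected_subgraph S G) \<and>
     (\<not> connected (delete_verts G (verts_of F)) \<or> trivial_graph (delete_verts G (verts_of F)))"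

definition structure_cut ::
    "('a, 'b) pre_digraph \<Rightarrow> ('c, 'd) pre_digraph \<Rightarrow> ('a, 'b) pre_digraph set \<Rightarrow> bool" where
  "structure_cut G H F \<longleftrightarrow> subgraph_cut G F \<and> (\<forall>S\<in>F. digraph_iso S H)"

text \<open>
  The value is \<open>0\<close> if no finite cut exists; hence a positive value is attained by some cut.
\<close>

definition structure_connectivity ::
    "('a, 'b) pre_digraph \<Rightarrow> ('c, 'd) pre_digraph \<Rightarrow> nat" where
  "structure_connectivity G H = Inf {card F | F. finite F \<and> structure_cut G H F}"

end

theory Submission
  imports Defs
begin

text \<open>
  The vertices \<open>(a\<^sub>0, a\<^sub>1, \<dots>)\<close> and \<open>(a\<^sub>0 + 2, a\<^sub>1, \<dots>)\<close> have the same neighbours. Identifying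
  such twins turns \<open>BH\<^sub>n\<close> into a bipartite \<open>n\<close>-regular graph \<open>Q\<close> without 4-cycles, and \<open>BH\<^sub>n - X\<close> is
  connected as soon as \<open>Q\<close> minus the dead classes (those contained in \<open>X\<close>) is connected. If \<open>X\<close> is
  covered by \<open>2n - 1\<close> edges, then every edge meets each side of the bipartition once and a dead class
  needs two vertices, so at most \<open>n - 1\<close> classes die on each side; and if no two dead classes are
  adjacent, fewer than \<open>2n - 2\<close> classes die altogether. That such a set of dead classes does not
  disconnect \<open>Q\<close> is shown by induction on \<open>n\<close>, cutting \<open>Q\<close> into four layers according to one
  coordinate. If a single layer violates the induction hypothesis, it contains so many of the dead
  classes that its surviving vertices escape to the other layers within three steps, unless the dead
  classes are exactly the other neighbours of the two ends of an edge; these are pairwise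
  non-adjacent because \<open>Q\<close> has no 4-cycle. If two layers violate it, they contain all dead classes and
  are consecutive, and the other two layers are intact.

  Conversely, the \<open>2n\<close> neighbours of a vertex, each paired with a neighbour other than the vertex and
  its twin, isolate that vertex from its twin.
\<close>

section \<open>The twin quotient\<close>

text \<open>
  The twin class \<open>{a # xs | odd a = b}\<close> is encoded as \<open>(b, xs)\<close>; its neighbours are the classes
  \<open>(\<not> b, ys)\<close> with \<open>ys \<in> qnbrs b xs\<close>.
\<close>

definition shift :: "bool \<Rightarrow> int \<Rightarrow> int" where
  "shift b x = (if b then x - 1 else x + 1) mod 4"

text \<open>Recursing on the leading coordinate makes each layer a copy of the smaller quotient. The
  base value \<open>{[]}\<close> produces the neighbour class in which only \<open>a\<^sub>0\<close>
  changes, so every degree is one more than the length of the list.\<close>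

fun qnbrs :: "bool \<Rightarrow> int list \<Rightarrow> int list set" where
  "qnbrs b [] = {[]}"
| "qnbrs b (x # xs) = insert (shift b x # xs) ((#) x ` qnbrs b xs)"

lemma shift_neq: "shift b x \<noteq> x"
  unfolding shift_def by (cases b; simp; presburger)

lemma shift_range: "shift b x \<in> {0, 1, 2, 3}"
  unfolding shift_def by (cases b; simp; presburger)

lemma shift_shift_neq: "x \<in> {0, 1, 2, 3} \<Longrightarrow> shift b (shift b x) \<noteq> x"
  by (auto simp: shift_def split: if_splits)

lemma shift_Not_shift: "x \<in> {0, 1, 2, 3} \<Longrightarrow> shift (\<not> b) (shift b x) = x"
  by (auto simp: shift_def split: if_splits)

lemma shift_inj: "x \<in> {0, 1, 2, 3} \<Longrightarrow> y \<in> {0, 1, 2, 3} \<Longrightarrow> shift b x = shift b y \<Longrightarrow> x = y"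
  by (metis shift_Not_shift)

lemma Nil_in_bh_verts: "xs \<in> bh_verts 0 \<longleftrightarrow> xs = []"
  by (auto simp: bh_verts_def)

lemma Cons_in_bh_verts:
  "x # xs \<in> bh_verts (Suc m) \<longleftrightarrow> x \<in> {0, 1, 2, 3} \<and> xs \<in> bh_verts m"
  by (auto simp: bh_verts_def)

lemma bh_verts_Suc_cases:
  assumes "v \<in> bh_verts (Suc m)"
  obtains x xs where "v = x # xs" "x \<in> {0, 1, 2, 3}" "xs \<in> bh_verts m"
proof (cases v)
  case Nil
  then show ?thesis using assms by (simp add: bh_verts_def)
next
  case (Cons x xs)
  then show ?thesis using assms that by (auto simp: Cons_in_bh_verts)
qed

lemma finite_bh_verts: "finite (bh_verts m)"
  using finite_lists_length_eq[of "{0, 1, 2, 3 :: int}" m]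
  by (simp add: bh_verts_def conj_commute)

lemma card_bh_verts: "card (bh_verts m) = 4 ^ m"
  using card_lists_length_eq[of "{0, 1, 2, 3 :: int}" m]
  by (simp add: bh_verts_def conj_commute numeral_eq_Suc)

lemma qnbrs_in_bh_verts: "xs \<in> bh_verts m \<Longrightarrow> ys \<in> qnbrs b xs \<Longrightarrow> ys \<in> bh_verts m"
proof (induction b xs arbitrary: m ys rule: qnbrs.induct)
  case (1 b)
  then show ?case by simp
next
  case (2 b x xs)
  then obtain k where k: "m = Suc k" by (cases m) (auto simp: bh_verts_def)
  show ?case using 2 shift_range by (auto simp: k Cons_in_bh_verts)
qed

lemma qnbrs_sym:
  "xs \<in> bh_verts m \<Longrightarrow> ys \<in> qnbrs b xs \<Longrightarrow> xs \<in> qnbrs (\<not> b) ys"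
proof (induction b xs arbitrary: m ys rule: qnbrs.induct)
  case (1 b)
  then show ?case by simp
next
  case (2 b x xs)
  then obtain k where k: "m = Suc k" by (cases m) (auto simp: bh_verts_def)
  show ?case using 2 shift_Not_shift by (auto simp: k Cons_in_bh_verts)
qed

lemma finite_qnbrs: "finite (qnbrs b xs)"
  by (induction b xs rule: qnbrs.induct) auto

lemma card_qnbrs: "card (qnbrs b xs) = Suc (length xs)"
proof (induction b xs rule: qnbrs.induct)
  case (2 b x xs)
  then show ?case using shift_neq[of b x] by (auto simp: finite_qnbrs card_image card_insert_if)
qed simp

text \<open>This is the absence of 4-cycles. Equal heads reduce to the tails. If the heads differ, a
  common neighbour must shift exactly one of them onto the other, and since shifting twice is never
  the identity, only one direction is possible.\<close>

lemma qnbrs_common_unique: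
  assumes "xs \<in> bh_verts m" "xs' \<in> bh_verts m" "xs \<noteq> xs'"
    and "ys \<in> qnbrs b xs" "ys \<in> qnbrs b xs'" "ys' \<in> qnbrs b xs" "ys' \<in> qnbrs b xs'"
  shows "ys = ys'"
  using assms
proof (induction m arbitrary: xs xs' ys ys')
  case 0
  then show ?case by (simp add: Nil_in_bh_verts)
next
  case (Suc m)
  obtain x vs where x: "xs = x # vs" "x \<in> {0, 1, 2, 3}" "vs \<in> bh_verts m"
    using Suc.prems(1) by (rule bh_verts_Suc_cases)
  obtain x' vs' where x': "xs' = x' # vs'" "x' \<in> {0, 1, 2, 3}" "vs' \<in> bh_verts m"
    using Suc.prems(2) by (rule bh_verts_Suc_cases)
  show ?case
  proof (cases "x = x'")
    case True
    then have "vs \<noteq> vs'" using Suc.prems x x' by simp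
    then show ?thesis
      using Suc.prems(4-) Suc.IH[OF x(3) x'(3)] True x x' by (auto simp: shift_neq)
  next
    case False
    have "(x = shift b x' \<and> z = x # vs') \<or> (x' = shift b x \<and> z = x' # vs)"
      if "z \<in> qnbrs b xs" "z \<in> qnbrs b xs'" for z
      using that False x x' shift_inj[OF x(2) x'(2), of b] by (auto)
    then show ?thesis
      using Suc.prems(4-) False x x' shift_shift_neq by metis
  qed
qed

section \<open>Connectivity of the quotient without its dead classes\<close>

type_synonym qset = "bool \<Rightarrow> int list set"

definition qedges :: "nat \<Rightarrow> qset \<Rightarrow> ((bool \<times> int list) \<times> (bool \<times> int list)) set" where
  "qedges m D = {((b, xs), (\<not> b, ys)) | b xs ys.
     xs \<in> bh_verts m - D b \<and> ys \<in> qnbrs b xs - D (\<not> b)}"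

abbreviation qlinked :: "nat \<Rightarrow> qset \<Rightarrow> bool \<times> int list \<Rightarrow> bool \<times> int list \<Rightarrow> bool" where
  "qlinked m D u v \<equiv> (u, v) \<in> (qedges m D)\<^sup>*"

definition qconn :: "nat \<Rightarrow> qset \<Rightarrow> bool" where
  "qconn m D \<longleftrightarrow> (\<forall>b c. \<forall>xs\<in>bh_verts m - D b. \<forall>ys\<in>bh_verts m - D c. qlinked m D (b, xs) (c, ys))"

text \<open>The invariant of the induction. Degrees are \<open>m + 1\<close>, so \<open>m\<close>
  dead classes on each side could cut off an edge by being all other neighbours of its ends. As
  there are no 4-cycles, such a set contains no edge, and the second clause rules it out.\<close>

definition qgood :: "nat \<Rightarrow> qset \<Rightarrow> bool" where
  "qgood m D \<longleftrightarrow> (\<forall>b. card (D b) \<le> m) \<and>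
     (card (D True) + card (D False) < 2 * m \<or> (\<exists>xs\<in>D False. \<exists>ys\<in>D True. ys \<in> qnbrs False xs))"

definition layer :: "int \<Rightarrow> qset \<Rightarrow> qset" where
  "layer k D b = {xs. k # xs \<in> D b}"

lemma qlinked_edge:
  "xs \<in> bh_verts m \<Longrightarrow> xs \<notin> D b \<Longrightarrow> ys \<in> qnbrs b xs \<Longrightarrow> ys \<notin> D (\<not> b) \<Longrightarrow>
    qlinked m D (b, xs) (\<not> b, ys)"
  by (auto simp: qedges_def)

lemma sym_qedges: "sym (qedges m D)"
  by (rule symI) (auto simp: qedges_def intro: qnbrs_in_bh_verts dest: qnbrs_sym)

lemma qlinked_sym: "qlinked m D u v \<Longrightarrow> qlinked m D v u"
  using sym_rtrancl[OF sym_qedges] by (rule symD)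

lemma qlinked_layer:
  assumes "qlinked m (layer k D) (b, xs) (c, ys)" "k \<in> {0, 1, 2, 3}"
  shows "qlinked (Suc m) D (b, k # xs) (c, k # ys)"
  using assms(1)
proof (induction rule: rtrancl_induct2)
  case refl
  then show ?case by simp
next
  case (step b' xs' c' ys')
  then have "((b', k # xs'), (c', k # ys')) \<in> qedges (Suc m) D"
    using assms(2) by (auto simp: qedges_def layer_def Cons_in_bh_verts)
  then show ?case using step.IH by simp
qed

section \<open>Base case: the 8-cycle\<close>

lemma bh_verts_1: "bh_verts 1 = {[0], [1], [2], [3]}"
  by (auto simp: bh_verts_def length_Suc_conv)

text \<open>For lists of length one the quotient is an 8-cycle. It loses at most one class on each
  side, and if it loses two, they are adjacent; the rest is still connected.\<close>

lemma qconn_1: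
  assumes sub: "\<And>b. D b \<subseteq> bh_verts 1" and good: "qgood 1 D"
  shows "qconn 1 D"
proof -
  have one: "x = y" if "x \<in> D b" "y \<in> D b" for x y b
  proof -
    have "finite (D b)" using sub finite_bh_verts finite_subset by blast
    then show ?thesis using good that card_le_Suc0_iff_eq[of "D b"] by (auto simp: qgood_def)
  qed
  have fin: "finite (D b)" for b using sub finite_bh_verts finite_subset by blast
  have two: "D True = {} \<or> D False = {} \<or> (\<exists>xs\<in>D False. \<exists>ys\<in>D True. ys \<in> qnbrs False xs)"
  proof -
    have "card (D True) = 0 \<or> card (D False) = 0" if "card (D True) + card (D False) < 2 * 1"
      using that by linarith
    then show ?thesis using good fin unfolding qgood_def by auto
  qed
  have "qlinked 1 D (b, xs) (c, ys)"
    if xs: "xs \<in> bh_verts 1 - D b" and ys: "ys \<in> bh_verts 1 - D c" for b c xs ys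
  proof -
    define r where "r c ys = qlinked 1 D (b, xs) (c, ys)" for c ys
    have step: "r (\<not> c) ys"
      if "r c xs" "xs \<in> bh_verts 1" "xs \<notin> D c" "ys \<in> qnbrs c xs" "ys \<notin> D (\<not> c)" for c xs ys
      using that qlinked_edge[of xs 1 D c ys] unfolding r_def by (meson rtrancl_trans)
    have r0: "r b xs" by (simp add: r_def)
    have adj: "[0] \<notin> D True \<Longrightarrow> [0] \<notin> D False \<Longrightarrow> r True [0] \<longleftrightarrow> r False [0]"
         "[1] \<notin> D True \<Longrightarrow> [1] \<notin> D False \<Longrightarrow> r True [1] \<longleftrightarrow> r False [1]"
         "[2] \<notin> D True \<Longrightarrow> [2] \<notin> D False \<Longrightarrow> r True [2] \<longleftrightarrow> r False [2]"
         "[3] \<notin> D True \<Longrightarrow> [3] \<notin> D False \<Longrightarrow> r True [3] \<longleftrightarrow> r False [3]"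
         "[1] \<notin> D True \<Longrightarrow> [0] \<notin> D False \<Longrightarrow> r True [1] \<longleftrightarrow> r False [0]"
         "[2] \<notin> D True \<Longrightarrow> [1] \<notin> D False \<Longrightarrow> r True [2] \<longleftrightarrow> r False [1]"
         "[3] \<notin> D True \<Longrightarrow> [2] \<notin> D False \<Longrightarrow> r True [3] \<longleftrightarrow> r False [2]"
         "[0] \<notin> D True \<Longrightarrow> [3] \<notin> D False \<Longrightarrow> r True [0] \<longleftrightarrow> r False [3]"
      using step[of True] step[of False] unfolding bh_verts_1 by (auto simp: shift_def)
    have uniq: "\<not> ([0] \<in> D b \<and> [1] \<in> D b)" "\<not> ([0] \<in> D b \<and> [2] \<in> D b)" "\<not> ([0] \<in> D b \<and> [3] \<in> D b)"
      "\<not> ([1] \<in> D b \<and> [2] \<in> D b)" "\<not> ([1] \<in> D b \<and> [3] \<in> D b)" "\<not> ([2] \<in> D b \<and> [3] \<in> D b)" for b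
      using one[of _ b] by fastforce+
    have edge:
      "([0] \<notin> D True \<and> [1] \<notin> D True \<and> [2] \<notin> D True \<and> [3] \<notin> D True) \<or>
       ([0] \<notin> D False \<and> [1] \<notin> D False \<and> [2] \<notin> D False \<and> [3] \<notin> D False) \<or>
       [0] \<in> D False \<and> [0] \<in> D True \<or> [0] \<in> D False \<and> [1] \<in> D True \<or>
       [1] \<in> D False \<and> [1] \<in> D True \<or> [1] \<in> D False \<and> [2] \<in> D True \<or>
       [2] \<in> D False \<and> [2] \<in> D True \<or> [2] \<in> D False \<and> [3] \<in> D True \<or>
       [3] \<in> D False \<and> [3] \<in> D True \<or> [3] \<in> D False \<and> [0] \<in> D True"
    proof -
      have *: "xs \<in> {[0], [1], [2], [3]}" if "xs \<in> D False" for xs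
        using that sub[of False] unfolding bh_verts_1 by auto
      show ?thesis using two
      proof (elim disjE bexE)
        fix xs ys assume "xs \<in> D False" "ys \<in> D True" "ys \<in> qnbrs False xs"
        then show ?thesis using *[of xs] by (auto simp: shift_def)
      qed simp_all
    qed
    \<comment> \<open>Propositional form of connectivity: reachability holds at all live classes or
      at none, and the starting class excludes the latter.\<close>
    have
      "(([0] \<in> D True \<or> r True [0]) \<and> ([0] \<in> D False \<or> r False [0]) \<and>
        ([1] \<in> D True \<or> r True [1]) \<and> ([1] \<in> D False \<or> r False [1]) \<and>
        ([2] \<in> D True \<or> r True [2]) \<and> ([2] \<in> D False \<or> r False [2]) \<and>
        ([3] \<in> D True \<or> r True [3]) \<and> ([3] \<in> D False \<or> r False [3])) \<or>
       (([0] \<in> D True \<or> \<not> r True [0]) \<and> ([0] \<in> D False \<or> \<not> r False [0]) \<and>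
        ([1] \<in> D True \<or> \<not> r True [1]) \<and> ([1] \<in> D False \<or> \<not> r False [1]) \<and>
        ([2] \<in> D True \<or> \<not> r True [2]) \<and> ([2] \<in> D False \<or> \<not> r False [2]) \<and>
        ([3] \<in> D True \<or> \<not> r True [3]) \<and> ([3] \<in> D False \<or> \<not> r False [3]))"
      using adj uniq[of True] uniq[of False] edge by argo
    then have "r c ys"
      using r0 xs ys unfolding bh_verts_1 by (cases b; cases c) auto
    then show ?thesis by (simp add: r_def)
  qed
  then show ?thesis by (simp add: qconn_def)
qed

section \<open>Layers\<close>

lemma layers_partition:
  assumes "j \<in> {0, 1, 2, 3 :: int}"
  shows "{0, 1, 2, 3} =
    {j, shift False j, shift False (shift False j), shift False (shift False (shift False j))}"
    and "distinct [j, shift False j, shift False (shift False j),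
      shift False (shift False (shift False j))]"
    and "shift True j = shift False (shift False (shift False j))"
  using assms by (auto simp: shift_def)

lemma card_layers:
  assumes "D b \<subseteq> bh_verts (Suc m)"
  shows "card (D b) = (\<Sum>k\<in>{0, 1, 2, 3}. card (layer k D b))"
proof -
  have fin: "finite (D b)" using assms finite_bh_verts finite_subset by blast
  have eq: "D b = (\<Union>k\<in>{0, 1, 2, 3}. (#) k ` layer k D b)"
  proof (intro equalityI subsetI)
    fix v assume v: "v \<in> D b"
    then have "v \<in> bh_verts (Suc m)" using assms by blast
    then obtain k xs where "v = k # xs" "k \<in> {0, 1, 2, 3}" by (rule bh_verts_Suc_cases)
    then show "v \<in> (\<Union>k\<in>{0, 1, 2, 3}. (#) k ` layer k D b)"
      using v unfolding layer_def by blast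
  qed (auto simp: layer_def)
  have "card (D b) = (\<Sum>k\<in>{0, 1, 2, 3}. card ((#) k ` layer k D b))"
  proof (subst eq, rule card_UN_disjoint)
    show "\<forall>k\<in>{0, 1, 2, 3}. finite ((#) k ` layer k D b)"
      using fin by (auto intro!: finite_subset[OF _ fin] simp: layer_def)
  qed auto
  also have "\<dots> = (\<Sum>k\<in>{0, 1, 2, 3}. card (layer k D b))"
    by (intro sum.cong refl card_image) simp
  finally show ?thesis .
qed

lemma layer_subset: "D b \<subseteq> bh_verts (Suc m) \<Longrightarrow> layer k D b \<subseteq> bh_verts m"
  unfolding layer_def using Cons_in_bh_verts by blast

lemma finite_layer: "D b \<subseteq> bh_verts (Suc m) \<Longrightarrow> finite (layer k D b)"
  using layer_subset[of D b m k] finite_bh_verts finite_subset by blast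

section \<open>Linking whole layers to each other\<close>

lemma two_mult_less_four_power: "2 * m < 4 ^ (m :: nat)"
  by (induction m) auto

definition layers_linked :: "nat \<Rightarrow> qset \<Rightarrow> int \<Rightarrow> int \<Rightarrow> bool" where
  "layers_linked m D k l \<longleftrightarrow> (\<forall>b c. \<forall>xs\<in>bh_verts m - layer k D b. \<forall>ys\<in>bh_verts m - layer l D c.
     qlinked (Suc m) D (b, k # xs) (c, l # ys))"

lemma layers_linked_sym: "layers_linked m D k l \<Longrightarrow> layers_linked m D l k"
  by (auto simp: layers_linked_def intro: qlinked_sym)

lemma qconn_layers_linked:
  "qconn m (layer k D) \<Longrightarrow> k \<in> {0, 1, 2, 3} \<Longrightarrow> layers_linked m D k k"
  unfolding qconn_def layers_linked_def by (blast intro: qlinked_layer)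

lemma ex_bh_vert_notin:
  assumes "card A < 4 ^ m" "finite A"
  shows "\<exists>xs\<in>bh_verts m. xs \<notin> A"
proof (rule ccontr)
  assume "\<not> ?thesis"
  then have "bh_verts m \<subseteq> A" by blast
  then have "card (bh_verts m) \<le> card A" using assms(2) by (rule card_mono[rotated])
  then show False using assms by (simp add: card_bh_verts)
qed

text \<open>The middle layer must have a live class, for otherwise both assumptions hold vacuously;
  at most \<open>m < 4 ^ m\<close> dead classes on one side leave one.\<close>

lemma layers_linked_trans:
  assumes "layers_linked m D k l" "layers_linked m D l p"
    and "D True \<subseteq> bh_verts (Suc m)" "card (layer l D True) \<le> m"
  shows "layers_linked m D k p"
proof -
  have "finite (layer l D True)"
    using finite_layer[of D True, OF assms(3)] .
  moreover have "card (layer l D True) < 4 ^ m"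
    using assms(4) two_mult_less_four_power[of m] by linarith
  ultimately obtain zs where "zs \<in> bh_verts m - layer l D True"
    using ex_bh_vert_notin by blast
  then show ?thesis
    using assms(1,2) unfolding layers_linked_def by (meson rtrancl_trans)
qed

text \<open>Each \<open>zs\<close> gives an edge from \<open>(False, k # zs)\<close> to
  \<open>(True, shift False k # zs)\<close>. These \<open>4 ^ m\<close> edges are disjoint and at
  most \<open>2 * m\<close> of them lose an end, so one survives to join the two connected
  layers.\<close>

lemma layers_linked_next:
  assumes sub: "\<And>b. D b \<subseteq> bh_verts (Suc m)" and k: "k \<in> {0, 1, 2, 3}"
    and conn: "qconn m (layer k D)" "qconn m (layer (shift False k) D)"
    and card: "card (layer k D False) \<le> m" "card (layer (shift False k) D True) \<le> m"
  shows "layers_linked m D k (shift False k)"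
proof -
  let ?l = "shift False k"
  have fin: "finite (layer k D False \<union> layer ?l D True)"
    using finite_layer[of D, OF sub] by simp
  have "card (layer k D False \<union> layer ?l D True) < 4 ^ m"
    using card two_mult_less_four_power[of m] card_Un_le[of "layer k D False" "layer ?l D True"]
    by linarith
  then obtain zs where zs: "zs \<in> bh_verts m" "zs \<notin> layer k D False" "zs \<notin> layer ?l D True"
    using ex_bh_vert_notin[OF _ fin] by blast
  have link: "qlinked (Suc m) D (False, k # zs) (True, ?l # zs)"
    using qlinked_edge[of "k # zs" "Suc m" D False "?l # zs"] zs k
    by (simp add: Cons_in_bh_verts layer_def)
  have k': "layers_linked m D k k" "layers_linked m D ?l ?l"
    using qconn_layers_linked conn k shift_range by auto
  show ?thesis
    unfolding layers_linked_def
  proof (intro allI ballI)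
    fix b c xs ys
    assume xs: "xs \<in> bh_verts m - layer k D b" and ys: "ys \<in> bh_verts m - layer ?l D c"
    have "qlinked (Suc m) D (b, k # xs) (False, k # zs)"
      using k'(1) xs zs unfolding layers_linked_def by blast
    moreover have "qlinked (Suc m) D (True, ?l # zs) (c, ?l # ys)"
      using k'(2) ys zs unfolding layers_linked_def by blast
    ultimately show "qlinked (Suc m) D (b, k # xs) (c, ?l # ys)"
      using link by (meson rtrancl_trans)
  qed
qed

lemma qconn_Suc_if_core:
  assumes core: "\<And>k l. k \<in> K \<Longrightarrow> l \<in> K \<Longrightarrow> layers_linked m D k l"
    and reach: "\<And>b k xs. k \<in> {0, 1, 2, 3} - K \<Longrightarrow> xs \<in> bh_verts m - layer k D b \<Longrightarrow>
      \<exists>c. \<exists>l\<in>K. \<exists>ys\<in>bh_verts m - layer l D c. qlinked (Suc m) D (b, k # xs) (c, l # ys)"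
  shows "qconn (Suc m) D"
proof -
  have reach': "\<exists>c. \<exists>l\<in>K. \<exists>ys\<in>bh_verts m - layer l D c. qlinked (Suc m) D (b, v) (c, l # ys)"
    if v: "v \<in> bh_verts (Suc m) - D b" for b v
  proof -
    from v have "v \<in> bh_verts (Suc m)" by simp
    then obtain k xs where kxs: "v = k # xs" "k \<in> {0, 1, 2, 3}" "xs \<in> bh_verts m"
      by (rule bh_verts_Suc_cases)
    then have xs: "xs \<in> bh_verts m - layer k D b" using v by (simp add: layer_def)
    show ?thesis
    proof (cases "k \<in> K")
      case True
      then show ?thesis using xs kxs by blast
    next
      case False
      then show ?thesis using reach[of k xs b] xs kxs by blast
    qed
  qed
  show ?thesis
    unfolding qconn_def
  proof (intro allI ballI)
    fix b c v w
    assume v: "v \<in> bh_verts (Suc m) - D b" and w: "w \<in> bh_verts (Suc m) - D c"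
    obtain b' k xs where x: "k \<in> K" "xs \<in> bh_verts m - layer k D b'"
      "qlinked (Suc m) D (b, v) (b', k # xs)" using reach'[OF v] by blast
    obtain c' l ys where y: "l \<in> K" "ys \<in> bh_verts m - layer l D c'"
      "qlinked (Suc m) D (c, w) (c', l # ys)" using reach'[OF w] by blast
    have "qlinked (Suc m) D (b', k # xs) (c', l # ys)"
      using core[OF x(1) y(1)] x(2) y(2) unfolding layers_linked_def by blast
    then show "qlinked (Suc m) D (b, v) (c, w)"
      using x(3) qlinked_sym[OF y(3)] by (meson rtrancl_trans)
  qed
qed

section \<open>Counting dead classes and escaping from a bad layer\<close>

lemma card_two_layers:
  assumes "D b \<subseteq> bh_verts (Suc m)" "k \<in> {0, 1, 2, 3}" "l \<in> {0, 1, 2, 3}" "k \<noteq> l"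
  shows "card (layer k D b) + card (layer l D b) \<le> card (D b)"
proof -
  have "card (layer k D b) + card (layer l D b) = (\<Sum>i\<in>{k, l}. card (layer i D b))"
    using assms by simp
  also have "\<dots> \<le> (\<Sum>i\<in>{0, 1, 2, 3}. card (layer i D b))"
    using assms by (intro sum_mono2) auto
  finally show ?thesis using card_layers[of D b, OF assms(1)] by simp
qed

lemma card_layer_pos:
  assumes "D b \<subseteq> bh_verts (Suc m)" "k # xs \<in> D b"
  shows "card (layer k D b) \<ge> 1"
  using assms finite_layer[of D b, OF assms(1), of k] card_gt_0_iff[of "layer k D b"]
  by (auto simp: layer_def Suc_le_eq)

text \<open>Either one side exceeds \<open>m\<close>, or both sides together reach
  \<open>2 * m\<close>, which is at least \<open>m + 1\<close>. Two bad layers therefore use up all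
  \<open>2 * m + 2\<close> dead classes that \<open>qgood (Suc m)\<close> allows.\<close>

lemma bad_layer_card:
  assumes "\<not> qgood m D" "m \<ge> 1"
  shows "card (D True) + card (D False) \<ge> Suc m"
proof -
  from assms(1) obtain b where
    "card (D b) > m \<or> card (D True) + card (D False) \<ge> 2 * m"
    unfolding qgood_def by (meson not_le)
  then show ?thesis using assms(2) by (cases b) auto
qed

lemma ex_qnbr_notin:
  assumes "card A \<le> length xs" "finite A"
  obtains ys where "ys \<in> qnbrs b xs" "ys \<notin> A"
proof -
  have "\<not> qnbrs b xs \<subseteq> A"
    using card_mono[of A "qnbrs b xs"] assms by (auto simp: card_qnbrs)
  then show ?thesis using that by blast
qed

lemma unique_outside_layer:
  assumes sub: "D c \<subseteq> bh_verts (Suc m)" and card: "card (D c) \<le> Suc (card (layer j D c))"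
    and "k # xs \<in> D c" "l # ys \<in> D c" "k \<noteq> j" "l \<noteq> j"
  shows "k # xs = l # ys"
proof -
  let ?R = "D c - (#) j ` layer j D c"
  have fin: "finite (D c)" using sub finite_bh_verts finite_subset by blast
  have "card ?R = card (D c) - card ((#) j ` layer j D c)"
    by (rule card_Diff_subset) (use finite_layer[of D c, OF sub] in \<open>auto simp: layer_def\<close>)
  also have "card ((#) j ` layer j D c) = card (layer j D c)"
    by (intro card_image) simp
  finally have "card ?R \<le> Suc 0" using card by simp
  then have "\<forall>x\<in>?R. \<forall>y\<in>?R. x = y" using fin by (simp add: card_le_Suc0_iff_eq)
  moreover have "k # xs \<in> ?R" "l # ys \<in> ?R" using assms by auto
  ultimately show ?thesis by blast
qed

text \<open>A live class that cannot escape and a live neighbour of it would each have a dead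
  neighbour outside the layer. Badness then fixes all cardinalities, and the dead classes are
  exactly the other neighbours of the two, which the invariant forbids.\<close>

lemma leave_bad_layer:
  assumes sub: "\<And>b. D b \<subseteq> bh_verts (Suc m)" and good: "qgood (Suc m) D"
    and j: "j \<in> {0, 1, 2, 3}" and bad: "\<not> qgood m (layer j D)"
    and xs: "xs \<in> bh_verts m - layer j D b"
  shows "\<exists>c. \<exists>l\<in>{0, 1, 2, 3} - {j}. \<exists>ys\<in>bh_verts m - layer l D c.
    qlinked (Suc m) D (b, j # xs) (c, l # ys)"
proof (rule ccontr)
  assume stuck: "\<not> ?thesis"
  have fin: "finite (D c)" for c using sub finite_bh_verts finite_subset by blast
  have le: "card (D c) \<le> Suc m" for c using good by (simp add: qgood_def)
  have v: "j # xs \<in> bh_verts (Suc m)" "j # xs \<notin> D b"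
    using xs j by (auto simp: Cons_in_bh_verts layer_def)
  \<comment> \<open>Each class has exactly one neighbour outside its layer. A class of layer
    \<open>j\<close> reached from the stuck one could leave through it, so this exit must be
    dead.\<close>
  have dead: "shift c j # zs \<in> D (\<not> c)"
    if "j # zs \<in> bh_verts (Suc m)" "j # zs \<notin> D c" "qlinked (Suc m) D (b, j # xs) (c, j # zs)"
    for c zs
  proof (rule ccontr)
    assume n: "shift c j # zs \<notin> D (\<not> c)"
    then have "qlinked (Suc m) D (c, j # zs) (\<not> c, shift c j # zs)"
      using that by (intro qlinked_edge) auto
    with that(3) have "qlinked (Suc m) D (b, j # xs) (\<not> c, shift c j # zs)"
      by (rule rtrancl_trans)
    moreover have "shift c j \<in> {0, 1, 2, 3} - {j}" using shift_range shift_neq by auto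
    moreover have "zs \<in> bh_verts m - layer (shift c j) D (\<not> c)"
      using that(1) n by (simp add: Cons_in_bh_verts layer_def)
    ultimately show False using stuck by blast
  qed
  have inlayer: "\<exists>zs. z = j # zs \<and> j # zs \<in> bh_verts (Suc m) \<and> shift (\<not> c) j # zs \<in> D c"
    if u: "j # us \<in> bh_verts (Suc m)" "j # us \<notin> D c" "qlinked (Suc m) D (b, j # xs) (c, j # us)"
      "z \<in> qnbrs c (j # us)" "z \<notin> D (\<not> c)" for c us z
  proof -
    have z: "z \<in> bh_verts (Suc m)" using u qnbrs_in_bh_verts by blast
    have l: "qlinked (Suc m) D (b, j # xs) (\<not> c, z)"
      using u qlinked_edge[of "j # us" "Suc m" D c z] by (meson rtrancl_trans)
    have "z \<noteq> shift c j # us" using dead[OF u(1-3)] u(5) by blast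
    then obtain zs where "z = j # zs" using u(4) by auto
    then show ?thesis using dead[of zs "\<not> c"] z l u(5) by simp
  qed
  have dv: "shift b j # xs \<in> D (\<not> b)" using dead[of xs b] v by simp
  \<comment> \<open>The stuck class has \<open>m + 2\<close> neighbours, of which at most
    \<open>m + 1\<close> are dead.\<close>
  have "card (D (\<not> b)) \<le> length (j # xs)" using le[of "\<not> b"] v(1) by (simp add: bh_verts_def)
  then obtain w where w: "w \<in> qnbrs b (j # xs)" "w \<notin> D (\<not> b)"
    using ex_qnbr_notin fin by blast
  then obtain ys where ys: "w = j # ys" "j # ys \<in> bh_verts (Suc m)" "shift (\<not> b) j # ys \<in> D b"
    using inlayer[of xs b w] v by auto
  have lw: "qlinked (Suc m) D (b, j # xs) (\<not> b, j # ys)"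
    using v w ys by (intro qlinked_edge) auto
  \<comment> \<open>Each side has a dead class outside layer \<open>j\<close>: the exit of
    \<open>j # xs\<close> or that of \<open>j # ys\<close>.\<close>
  have le_m: "card (layer j D c) \<le> m" for c
  proof -
    have "card (layer (shift (\<not> c) j) D c) \<ge> 1"
      using card_layer_pos[of D, OF sub dv] card_layer_pos[of D, OF sub ys(3)]
      by (cases "c = b") auto
    then show ?thesis
      using card_two_layers[of D c m j "shift (\<not> c) j"] sub j shift_range shift_neq le[of c]
      by fastforce
  qed
  \<comment> \<open>With neither side above \<open>m\<close>, badness means a total of at least
    \<open>2 * m\<close> and no dead edge in the layer. So both sides have exactly \<open>m\<close>,
    and each side has a single dead class outside the layer.\<close>
  have ge: "card (layer j D True) + card (layer j D False) \<ge> 2 * m"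
    and noedge: "\<not> (\<exists>xs\<in>layer j D False. \<exists>ys\<in>layer j D True. ys \<in> qnbrs False xs)"
    using bad le_m by (auto simp: qgood_def not_less)
  have eq_m: "card (layer j D c) = m" for c
    using ge le_m[of True] le_m[of False] by (cases c) auto
  have uniq: "zs = zs'" if "k # zs \<in> D c" "k # zs' \<in> D c" "k \<noteq> j" for c k zs zs'
    using unique_outside_layer[of D c m j k zs k zs'] sub le[of c] eq_m[of c] that by simp
  \<comment> \<open>Another live neighbour of \<open>j # xs\<close> would lie in the layer and have
    its own dead exit, a second dead class outside the layer on side \<open>b\<close>.\<close>
  have sub_v: "qnbrs b (j # xs) - {j # ys} \<subseteq> D (\<not> b)"
  proof (rule subsetI, rule ccontr)
    fix z assume z: "z \<in> qnbrs b (j # xs) - {j # ys}" "z \<notin> D (\<not> b)"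
    then obtain zs where "z = j # zs" "shift (\<not> b) j # zs \<in> D b"
      using inlayer[of xs b z] v by auto
    then show False using uniq[of _ zs b ys] ys(3) z(1) shift_neq by blast
  qed
  have sub_w: "qnbrs (\<not> b) (j # ys) - {j # xs} \<subseteq> D b"
  proof (rule subsetI, rule ccontr)
    fix z assume z: "z \<in> qnbrs (\<not> b) (j # ys) - {j # xs}" "z \<notin> D b"
    then obtain zs where "z = j # zs" "shift b j # zs \<in> D (\<not> b)"
      using inlayer[of ys "\<not> b" z] ys w lw by auto
    then show False using uniq[of _ zs "\<not> b" xs] dv z(1) shift_neq by blast
  qed
  have w_in: "j # ys \<in> qnbrs b (j # xs)" using w ys by simp
  have v_in: "j # xs \<in> qnbrs (\<not> b) (j # ys)" using qnbrs_sym[OF v(1) w_in] .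
  have len: "length xs = m" "length ys = m" using v ys by (auto simp: bh_verts_def)
  \<comment> \<open>The inclusion is an equality because its left side has \<open>m + 1\<close>
    elements, the most that a side may lose.\<close>
  have eq_v: "qnbrs b (j # xs) - {j # ys} = D (\<not> b)"
    by (rule card_subset_eq[OF fin sub_v])
      (use w_in sub_v card_mono[OF fin sub_v] le[of "\<not> b"] len
        card_qnbrs[of b "j # xs"] finite_qnbrs[of b "j # xs"]
        in \<open>simp del: qnbrs.simps add: card_Diff_singleton\<close>)
  have eq_w: "qnbrs (\<not> b) (j # ys) - {j # xs} = D b"
    by (rule card_subset_eq[OF fin sub_w])
      (use v_in sub_w card_mono[OF fin sub_w] le[of b] len
        card_qnbrs[of "\<not> b" "j # ys"] finite_qnbrs[of "\<not> b" "j # ys"]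
        in \<open>simp del: qnbrs.simps add: card_Diff_singleton\<close>)
  have "card (D (\<not> b)) = Suc m" "card (D b) = Suc m"
    using eq_v eq_w v_in w_in len
    by (metis card_Diff_singleton card_qnbrs diff_Suc_1 length_Cons)+
  \<comment> \<open>The total is too large for the first alternative of \<open>qgood\<close>, so
    there is a dead edge. Oriented as \<open>p'\<close>, \<open>q'\<close>, it closes a 4-cycle with
    \<open>j # xs\<close> and \<open>j # ys\<close>.\<close>
  then have "\<not> card (D True) + card (D False) < 2 * Suc m" by (cases b) auto
  then obtain p q where pq: "p \<in> D False" "q \<in> D True" "q \<in> qnbrs False p"
    using good by (auto simp: qgood_def)
  then have "p \<in> qnbrs True q" using qnbrs_sym[of p "Suc m" q False] sub by auto
  then obtain p' q' where p': "p' \<in> D b" "q' \<in> D (\<not> b)" "q' \<in> qnbrs b p'"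
    using pq by (cases b) auto
  then have p'': "p' \<in> qnbrs (\<not> b) (j # ys)" "p' \<noteq> j # xs"
    and q'': "q' \<in> qnbrs b (j # xs)" "q' \<noteq> j # ys"
    using eq_v eq_w by blast+
  have "j # ys \<in> qnbrs b p'" using qnbrs_sym[OF ys(2) p''(1)] by simp
  moreover have "p' \<in> bh_verts (Suc m)" using p'(1) sub by blast
  ultimately show False
    using qnbrs_common_unique[OF v(1) _ p''(2)[symmetric] w_in _ q''(1) p'(3)] q''(2) by blast
qed

section \<open>Induction step, by the number of bad layers\<close>

lemma qconn_if_one_bad:
  assumes sub: "\<And>b. D b \<subseteq> bh_verts (Suc m)" and good: "qgood (Suc m) D"
    and IH: "\<And>k. k \<in> {0, 1, 2, 3} \<Longrightarrow> qgood m (layer k D) \<Longrightarrow> qconn m (layer k D)"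
    and j: "j \<in> {0, 1, 2, 3}" and others: "\<And>k. k \<in> {0, 1, 2, 3} - {j} \<Longrightarrow> qgood m (layer k D)"
  shows "qconn (Suc m) D"
proof -
  define f where "f = shift False"
  let ?K = "{f j, f (f j), f (f (f j))}"
  have K: "{0, 1, 2, 3} = insert j ?K" "j \<notin> ?K"
    using layers_partition(1,2)[OF j] unfolding f_def by simp_all
  have rng: "k \<in> {0, 1, 2, 3}" if "k \<in> insert j ?K" for k using K(1) that by blast
  have goodK: "qgood m (layer k D)" if "k \<in> ?K" for k
  proof (rule others)
    have "k \<noteq> j" using that K(2) by blast
    then show "k \<in> {0, 1, 2, 3} - {j}" using rng[of k] that by blast
  qed
  have le: "card (layer k D b) \<le> m" if "qgood m (layer k D)" for k b
    using that by (simp add: qgood_def)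
  have refl: "layers_linked m D k k" if "k \<in> {0, 1, 2, 3}" "qgood m (layer k D)" for k
    using that IH qconn_layers_linked by blast
  have nxt: "layers_linked m D k (f k)"
    if "k \<in> {0, 1, 2, 3}" "qgood m (layer k D)" "qgood m (layer (f k) D)" for k
    unfolding f_def
  proof (rule layers_linked_next[OF sub that(1)])
    show "qconn m (layer k D)" using that IH by blast
    show "qconn m (layer (shift False k) D)" using that IH shift_range by (simp add: f_def)
  qed (use that le in \<open>auto simp: f_def\<close>)
  have trans: "layers_linked m D k p"
    if "layers_linked m D k l" "layers_linked m D l p" "qgood m (layer l D)" for k l p
    using layers_linked_trans[OF that(1,2) sub] le[OF that(3)] by blast
  have g1: "qgood m (layer (f j) D)" and g2: "qgood m (layer (f (f j)) D)"
    and g3: "qgood m (layer (f (f (f j))) D)"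
    by (auto intro!: goodK)
  \<comment> \<open>The three layers other than \<open>j\<close> are consecutive under
    \<open>f\<close> and all good, so they link up into a core whether or not layer \<open>j\<close>
    is good.\<close>
  have l12: "layers_linked m D (f j) (f (f j))" using nxt rng g1 g2 by blast
  have l23: "layers_linked m D (f (f j)) (f (f (f j)))" using nxt rng g2 g3 by blast
  have l13: "layers_linked m D (f j) (f (f (f j)))" using trans l12 l23 g2 by blast
  have core: "layers_linked m D k l" if "k \<in> ?K" "l \<in> ?K" for k l
    using that l12 l23 l13 layers_linked_sym refl rng goodK by blast
  show ?thesis
  proof (cases "qgood m (layer j D)")
    case True
    have lj: "layers_linked m D j k" if "k \<in> ?K" for k
      using trans[OF nxt[OF j True g1] core[OF _ that] g1] by blast
    show ?thesis
    proof (rule qconn_Suc_if_core[where K = "insert j ?K"])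
      show "layers_linked m D k l" if "k \<in> insert j ?K" "l \<in> insert j ?K" for k l
        using that core[of k l] lj[of l] layers_linked_sym[OF lj[of k]] refl[OF j True]
        by (cases "k = j"; cases "l = j") (simp_all only: insert_iff simp_thms)
    next
      fix k assume "k \<in> {0, 1, 2, 3} - insert j ?K"
      then show "\<exists>c. \<exists>l\<in>insert j ?K. \<exists>ys\<in>bh_verts m - layer l D c.
        qlinked (Suc m) D (b, k # xs) (c, l # ys)" for b xs
        unfolding K(1)[symmetric] by simp
    qed
  next
    case False
    show ?thesis
    proof (rule qconn_Suc_if_core[where K = ?K])
      fix b k xs assume k: "k \<in> {0, 1, 2, 3} - ?K" and xs: "xs \<in> bh_verts m - layer k D b"
      then have "k = j" unfolding K(1) by blast
      moreover have "{0, 1, 2, 3} - {j} = ?K" unfolding K(1) using K(2) by blast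
      ultimately show "\<exists>c. \<exists>l\<in>?K. \<exists>ys\<in>bh_verts m - layer l D c.
        qlinked (Suc m) D (b, k # xs) (c, l # ys)"
        using leave_bad_layer[OF sub good j False] xs by simp
    qed (rule core)
  qed
qed

text \<open>Two bad layers hold all dead classes and force the maximal total, so the invariant
  supplies a dead edge. It must run between the bad layers, which are therefore consecutive; the two
  intact layers form the core.\<close>

lemma qconn_if_two_bad:
  assumes sub: "\<And>b. D b \<subseteq> bh_verts (Suc m)" and good: "qgood (Suc m) D" and m: "m \<ge> 1"
    and IH: "\<And>k. k \<in> {0, 1, 2, 3} \<Longrightarrow> qgood m (layer k D) \<Longrightarrow> qconn m (layer k D)"
    and jk: "j \<in> {0, 1, 2, 3}" "k \<in> {0, 1, 2, 3}" "j \<noteq> k"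
    and bad: "\<not> qgood m (layer j D)" "\<not> qgood m (layer k D)"
  shows "qconn (Suc m) D"
proof -
  define f where "f = shift False"
  let ?a = "\<lambda>i b. card (layer i D b)"
  have le: "card (D b) \<le> Suc m" for b using good by (simp add: qgood_def)
  define R where "R b = (\<Sum>i\<in>{0, 1, 2, 3} - {j, k}. ?a i b)" for b
  have sum: "card (D b) = ?a j b + ?a k b + R b" for b
  proof -
    have "card (D b) = (\<Sum>i\<in>{j, k}. ?a i b) + (\<Sum>i\<in>{0, 1, 2, 3} - {j, k}. ?a i b)"
      unfolding card_layers[of D b, OF sub]
      using jk by (subst add.commute, intro sum.subset_diff) auto
    then show ?thesis using jk(3) by (simp add: R_def)
  qed
  have ge: "?a j True + ?a j False \<ge> Suc m" "?a k True + ?a k False \<ge> Suc m"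
    using bad_layer_card m bad by blast+
  note facts = ge sum[of True] sum[of False] le[of True] le[of False]
  have R0: "R b = 0" for b
    using facts by (cases b) auto
  have tot: "?a j True + ?a j False = Suc m" "?a k True + ?a k False = Suc m"
    using facts by linarith+
  then have tot_D: "card (D True) + card (D False) = 2 * Suc m"
    using sum R0 by simp
  have empty: "layer i D b = {}" if "i \<in> {0, 1, 2, 3} - {j, k}" for i b
  proof -
    have "?a i b = 0" using R0[of b] that unfolding R_def by (subst (asm) sum_eq_0_iff) auto
    then show ?thesis using finite_layer[of D b, OF sub] by simp
  qed
  obtain p q where pq: "p \<in> D False" "q \<in> D True" "q \<in> qnbrs False p"
    using good tot_D by (auto simp: qgood_def)
  obtain h ps where p: "p = h # ps" "h \<in> {0, 1, 2, 3}" "ps \<in> bh_verts m"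
    using pq(1) sub bh_verts_Suc_cases by blast
  obtain h' qs where q: "q = h' # qs" "h' \<in> {0, 1, 2, 3}" "qs \<in> bh_verts m"
    using pq(2) sub bh_verts_Suc_cases by blast
  have hjk: "h \<in> {j, k}" "h' \<in> {j, k}"
    using empty[of h False] empty[of h' True] p q pq by (auto simp: layer_def)
  have pos: "?a h False \<ge> 1" "?a h' True \<ge> 1"
    using card_layer_pos[of D, OF sub] pq p q by blast+
  \<comment> \<open>Inside one layer the dead edge would occupy both sides, so neither side could
    have all \<open>m + 1\<close> dead classes, and the layer would be good.\<close>
  have "h \<noteq> h'"
  proof
    assume eq: "h = h'"
    have "?a h True + ?a h False = Suc m" using tot(1,2) hjk by auto
    then have "?a h b \<le> m" for b using pos eq by (cases b) auto
    moreover have "ps \<in> layer h D False" "qs \<in> layer h D True" "qs \<in> qnbrs False ps"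
      using eq pq p q shift_neq by (auto simp: layer_def)
    ultimately have "qgood m (layer h D)" by (auto simp: qgood_def)
    then show False using bad hjk by auto
  qed
  then have h': "h' = f h" using pq(3) p q by (auto simp: f_def)
  have jk_eq: "{j, k} = {h, f h}" using hjk h' \<open>h \<noteq> h'\<close> by auto
  \<comment> \<open>Each end of the dead edge takes one of the at most \<open>m + 1\<close> dead
    classes of its side, leaving at most \<open>m\<close> for the other bad layer.\<close>
  have few: "?a h True \<le> m" "?a (f h) False \<le> m"
    using card_two_layers[of D True m h "f h"] card_two_layers[of D False m h "f h"]
      sub p(2) q(2) h' \<open>h \<noteq> h'\<close> pos le[of True] le[of False] by auto
  have K: "{0, 1, 2, 3} = {h, f h, f (f h), f (f (f h))}"
    "f (f h) \<noteq> h" "f (f h) \<noteq> f h" "f (f (f h)) \<noteq> h" "f (f (f h)) \<noteq> f h"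
    "shift True h = f (f (f h))"
    using layers_partition[OF p(2)] unfolding f_def by auto
  let ?K = "{f (f h), f (f (f h))}"
  have KK: "?K \<subseteq> {0, 1, 2, 3} - {j, k}" using jk_eq K by auto
  have goodK: "qgood m (layer i D)" if "i \<in> ?K" for i
    using that KK empty[of i] m by (auto simp: qgood_def)
  have connK: "qconn m (layer i D)" if "i \<in> ?K" for i
    using that KK IH goodK by blast
  have cross: "layers_linked m D (f (f h)) (f (f (f h)))"
    unfolding f_def
    by (rule layers_linked_next[OF sub]) (use KK connK goodK in \<open>auto simp: f_def qgood_def\<close>)
  have core: "layers_linked m D i l" if "i \<in> ?K" "l \<in> ?K" for i l
  proof -
    have "layers_linked m D i i" "layers_linked m D l l"
      using that KK connK qconn_layers_linked by blast+
    then show ?thesis using that cross layers_linked_sym by blast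
  qed
  show ?thesis
  proof (rule qconn_Suc_if_core[where K = ?K])
    have direct: "\<exists>c. \<exists>l\<in>?K. \<exists>ys\<in>bh_verts m - layer l D c.
      qlinked (Suc m) D (b, i # xs) (c, l # ys)"
      if "i \<in> {0, 1, 2, 3}" "shift b i \<in> ?K" "xs \<in> bh_verts m - layer i D b" for b i xs
    proof -
      have "layer (shift b i) D (\<not> b) = {}" using empty that KK by blast
      then have "shift b i # xs \<notin> D (\<not> b)" by (auto simp: layer_def)
      then have "qlinked (Suc m) D (b, i # xs) (\<not> b, shift b i # xs)"
        using that by (intro qlinked_edge) (auto simp: Cons_in_bh_verts layer_def)
      then show ?thesis using that \<open>layer (shift b i) D (\<not> b) = {}\<close> by blast
    qed
    \<comment> \<open>Classes facing the other bad layer first move to a live neighbour in their own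
      layer, one of \<open>m + 1\<close> candidates of which \<open>few\<close> leaves one alive,
      and exit from there to an intact layer.\<close>
    have indirect: "\<exists>c. \<exists>l\<in>?K. \<exists>ys\<in>bh_verts m - layer l D c.
      qlinked (Suc m) D (b, i # xs) (c, l # ys)"
      if i: "i \<in> {0, 1, 2, 3}" and "shift (\<not> b) i \<in> ?K" and "?a i (\<not> b) \<le> m"
        and xs: "xs \<in> bh_verts m - layer i D b" for b i xs
    proof -
      have "?a i (\<not> b) \<le> length xs" using that by (simp add: bh_verts_def)
      then obtain ys where ys: "ys \<in> qnbrs b xs" "ys \<notin> layer i D (\<not> b)"
        using ex_qnbr_notin finite_layer[of D, OF sub] by blast
      have "qlinked (Suc m) D (b, i # xs) (\<not> b, i # ys)"
        using i xs ys by (intro qlinked_edge) (auto simp: Cons_in_bh_verts layer_def)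
      moreover have "ys \<in> bh_verts m - layer i D (\<not> b)" using xs ys qnbrs_in_bh_verts by blast
      ultimately show ?thesis
        using direct[of i "\<not> b" ys] that by (meson rtrancl_trans)
    qed
    fix b i xs assume i: "i \<in> {0, 1, 2, 3} - ?K" and xs: "xs \<in> bh_verts m - layer i D b"
    then have "i = h \<or> i = f h" using K(1) by blast
    moreover have "shift True h \<in> ?K" "shift False (f h) \<in> ?K" using K by (auto simp: f_def)
    ultimately show "\<exists>c. \<exists>l\<in>?K. \<exists>ys\<in>bh_verts m - layer l D c.
      qlinked (Suc m) D (b, i # xs) (c, l # ys)"
      using direct[of i b xs] indirect[of i b xs] few i xs by (cases b) auto
  qed (rule core)
qed

theorem qconn_if_qgood:
  assumes "m \<ge> 1" "\<And>b. D b \<subseteq> bh_verts m" "qgood m D"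
  shows "qconn m D"
  using assms
proof (induction m arbitrary: D rule: nat_induct_at_least)
  case base
  then show ?case using qconn_1 by simp
next
  case (Suc m)
  have IH: "qconn m (layer k D)" if "qgood m (layer k D)" for k
    using Suc.IH[OF _ that] layer_subset[of D, OF Suc.prems(1)] by blast
  show ?case
  proof (cases "\<exists>j\<in>{0, 1, 2, 3}. \<exists>k\<in>{0, 1, 2, 3}. j \<noteq> k \<and>
      \<not> qgood m (layer j D) \<and> \<not> qgood m (layer k D)")
    case True
    then show ?thesis
      using qconn_if_two_bad[OF Suc.prems Suc.hyps(1) IH] by blast
  next
    case False
    show ?thesis
    proof (cases "\<exists>j\<in>{0, 1, 2, 3}. \<not> qgood m (layer j D)")
      case True
      then show ?thesis
        using qconn_if_one_bad[OF Suc.prems IH] False by blast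
    next
      case False
      \<comment> \<open>With all layers good, any choice of \<open>j\<close> will do.\<close>
      then show ?thesis using qconn_if_one_bad[OF Suc.prems IH, of 0] by blast
    qed
  qed
qed

section \<open>Arcs of the balanced hypercube\<close>

lemma qnbrs_eq: "qnbrs b xs = insert xs {xs[i := shift b (xs ! i)] | i. i < length xs}"
proof (induction b xs rule: qnbrs.induct)
  case (2 b x xs)
  have "{(x # xs)[i := shift b ((x # xs) ! i)] | i. i < length (x # xs)} =
    insert (shift b x # xs) ((#) x ` {xs[i := shift b (xs ! i)] | i. i < length xs})" (is "?L = ?R")
  proof (intro equalityI subsetI)
    fix v assume "v \<in> ?L"
    then obtain i where i: "i < length (x # xs)" "v = (x # xs)[i := shift b ((x # xs) ! i)]"
      by blast
    then show "v \<in> ?R" by (cases i) auto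
  next
    fix v assume "v \<in> ?R"
    then consider "v = shift b x # xs"
      | i where "i < length xs" "v = x # xs[i := shift b (xs ! i)]" by blast
    then show "v \<in> ?L"
    proof cases
      case 1
      then show ?thesis by (auto intro!: exI[of _ 0])
    next
      case (2 i)
      then show ?thesis by (auto intro!: exI[of _ "Suc i"])
    qed
  qed
  then show ?case using 2 by (simp add: insert_commute)
qed auto

text \<open>Adjacency sees the leading entries only through their parities; this is what makes the
  twin quotient faithful.\<close>

lemma Cons_in_bh_neighbours:
  assumes a: "a \<in> {0, 1, 2, 3}" and c: "c \<in> {0, 1, 2, 3}" and len: "length xs = m"
  shows "c # ys \<in> bh_neighbours (Suc m) (a # xs) \<longleftrightarrow> odd c \<noteq> odd a \<and> ys \<in> qnbrs (odd a) xs"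
proof -
  have sh: "(y + (-1) ^ nat a) mod 4 = shift (odd a) y" for y
    using a by (auto simp: shift_def)
  \<comment> \<open>Modulo 4, \<open>a + 1\<close> and \<open>a - 1\<close> are exactly the two
    entries of opposite parity.\<close>
  have par: "(\<exists>s\<in>{1, -1}. c = (a + s) mod 4) \<longleftrightarrow> odd c \<noteq> odd a"
    using a c by (simp only: insert_iff empty_iff simp_thms bex_simps) (elim disjE; simp)
  have "c # ys \<in> bh_neighbours (Suc m) (a # xs) \<longleftrightarrow>
    (\<exists>s\<in>{1, -1}. c = (a + s) mod 4) \<and>
    (ys = xs \<or> (\<exists>i. 1 \<le> i \<and> i \<le> m \<and> ys = xs[i - 1 := shift (odd a) (xs ! (i - 1))]))"
  proof -
    have *: "c # ys = (a # xs)[0 := (a + s) mod 4, i := ((a # xs) ! i + (-1) ^ nat a) mod 4] \<longleftrightarrow>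
      c = (a + s) mod 4 \<and> ys = xs[i - 1 := shift (odd a) (xs ! (i - 1))]" if "1 \<le> i" for s i
      using that by (cases i) (auto simp: sh)
    have "c # ys \<in> bh_neighbours (Suc m) (a # xs) \<longleftrightarrow>
      (\<exists>s\<in>{1, -1}. c # ys = (a # xs)[0 := (a + s) mod 4]) \<or>
      (\<exists>s\<in>{1, -1}. \<exists>i. 1 \<le> i \<and> i \<le> m \<and>
        c # ys = (a # xs)[0 := (a + s) mod 4, i := ((a # xs) ! i + (-1) ^ nat a) mod 4])"
      unfolding bh_neighbours_def nth_Cons_0 diff_Suc_1 by blast
    also have "\<dots> \<longleftrightarrow> (\<exists>s\<in>{1, -1}. c = (a + s) mod 4 \<and> ys = xs) \<or>
      (\<exists>s\<in>{1, -1}. \<exists>i. 1 \<le> i \<and> i \<le> m \<and>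
        c = (a + s) mod 4 \<and> ys = xs[i - 1 := shift (odd a) (xs ! (i - 1))])"
      using * by (simp only: list_update_code list.inject cong: conj_cong)
    finally show ?thesis by blast
  qed
  also have "(\<exists>i. 1 \<le> i \<and> i \<le> m \<and> ys = xs[i - 1 := shift (odd a) (xs ! (i - 1))]) \<longleftrightarrow>
    (\<exists>i<length xs. ys = xs[i := shift (odd a) (xs ! i)])"
  proof
    assume "\<exists>i. 1 \<le> i \<and> i \<le> m \<and> ys = xs[i - 1 := shift (odd a) (xs ! (i - 1))]"
    then obtain i where "1 \<le> i" "i \<le> m" "ys = xs[i - 1 := shift (odd a) (xs ! (i - 1))]" by blast
    then show "\<exists>i<length xs. ys = xs[i := shift (odd a) (xs ! i)]"
      using len by (intro exI[of _ "i - 1"]) auto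
  next
    assume "\<exists>i<length xs. ys = xs[i := shift (odd a) (xs ! i)]"
    then obtain i where "i < length xs" "ys = xs[i := shift (odd a) (xs ! i)]" by blast
    then show "\<exists>i. 1 \<le> i \<and> i \<le> m \<and> ys = xs[i - 1 := shift (odd a) (xs ! (i - 1))]"
      using len by (intro exI[of _ "Suc i"]) auto
  qed
  finally show ?thesis unfolding par qnbrs_eq by auto
qed

lemma bh_neighbours_in_bh_verts:
  assumes "v \<in> bh_verts (Suc m)" "w \<in> bh_neighbours (Suc m) v"
  shows "w \<in> bh_verts (Suc m)"
proof -
  show ?thesis
    using assms set_update_subset_insert[of v] set_update_subset_insert
    unfolding bh_neighbours_def bh_verts_def
    by (auto dest!: subsetD[OF set_update_subset_insert])
qed

lemma BH_arc_iff:
  "(a # xs, c # ys) \<in> parcs (BH (Suc m)) \<longleftrightarrow>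
    a # xs \<in> bh_verts (Suc m) \<and> c # ys \<in> bh_verts (Suc m) \<and> odd c \<noteq> odd a \<and> ys \<in> qnbrs (odd a) xs"
proof -
  have "c # ys \<in> bh_verts (Suc m)"
    if "a # xs \<in> bh_verts (Suc m)" "c # ys \<in> bh_neighbours (Suc m) (a # xs)"
    using that bh_neighbours_in_bh_verts by blast
  then show ?thesis
    using Cons_in_bh_neighbours[of a c xs m ys]
    by (auto simp: BH_def Cons_in_bh_verts bh_verts_def)
qed

lemma BH_arc_cases:
  assumes "(u, v) \<in> parcs (BH (Suc m))"
  obtains a xs c ys where "u = a # xs" "v = c # ys" "a # xs \<in> bh_verts (Suc m)"
    "c # ys \<in> bh_verts (Suc m)" "odd c \<noteq> odd a" "ys \<in> qnbrs (odd a) xs"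
proof -
  have uv: "u \<in> bh_verts (Suc m)" "v \<in> bh_verts (Suc m)"
    using assms bh_neighbours_in_bh_verts by (auto simp: BH_def)
  obtain a xs where "u = a # xs" using uv(1) by (rule bh_verts_Suc_cases)
  moreover obtain c ys where "v = c # ys" using uv(2) by (rule bh_verts_Suc_cases)
  ultimately show ?thesis using that assms uv BH_arc_iff by blast
qed

lemma BH_arc_sym: "(u, v) \<in> parcs (BH (Suc m)) \<Longrightarrow> (v, u) \<in> parcs (BH (Suc m))"
proof (elim BH_arc_cases)
  fix a xs c ys
  assume *: "u = a # xs" "v = c # ys" "a # xs \<in> bh_verts (Suc m)"
    "c # ys \<in> bh_verts (Suc m)" "odd c \<noteq> odd a" "ys \<in> qnbrs (odd a) xs"
  then have "xs \<in> qnbrs (odd c) ys"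
    using qnbrs_sym[of xs m ys "odd a"] by (simp add: Cons_in_bh_verts)
  with * show ?thesis by (simp add: BH_arc_iff)
qed

lemma pverts_BH: "pverts (BH n) = bh_verts n"
  by (simp add: BH_def)

lemma pair_graph_BH: "pair_graph (BH (Suc m))"
proof
  show "finite (pverts (BH (Suc m)))" by (simp add: pverts_BH finite_bh_verts)
  show "finite (parcs (BH (Suc m)))"
    by (rule finite_subset[of _ "bh_verts (Suc m) \<times> bh_verts (Suc m)"])
      (auto simp: finite_bh_verts elim: BH_arc_cases)
  show "symmetric (with_proj (BH (Suc m)))"
    by (auto simp: symmetric_def intro!: symI BH_arc_sym)
qed (auto simp: pverts_BH elim: BH_arc_cases)

section \<open>Cuts\<close>

definition twins :: "bool \<Rightarrow> int list set \<Rightarrow> int list set" where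
  "twins b A = {a # xs | a xs. a \<in> {0, 1, 2, 3} \<and> odd a = b \<and> xs \<in> A}"

lemma card_twins: "card (twins b A) = 2 * card A"
proof -
  let ?B = "if b then {1, 3} else {0, 2 :: int}"
  have "twins b A = (\<lambda>(a, xs). a # xs) ` (?B \<times> A)"
    by (auto simp: twins_def image_iff)
  also have "card \<dots> = card (?B \<times> A)" by (intro card_image inj_onI) auto
  also have "\<dots> = 2 * card A" by (simp add: card_cartesian_product)
  finally show ?thesis .
qed

lemma finite_twins: "finite A \<Longrightarrow> finite (twins b A)"
proof -
  assume "finite A"
  then have "finite ((\<lambda>(a, xs). a # xs) ` ({0, 1, 2, 3 :: int} \<times> A))" by simp
  moreover have "twins b A \<subseteq> (\<lambda>(a, xs). a # xs) ` ({0, 1, 2, 3} \<times> A)"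
    by (auto simp: twins_def)
  ultimately show ?thesis by (rule finite_subset[rotated])
qed

lemma card_verts_of_Int:
  assumes fin: "finite F"
    and edge: "\<And>S. S \<in> F \<Longrightarrow> \<exists>u v. (u, v) \<in> parcs G \<and> verts S = {u, v}"
    and indep: "\<And>u v. (u, v) \<in> parcs G \<Longrightarrow> u \<notin> P \<or> v \<notin> P"
  shows "card (verts_of F \<inter> P) \<le> card F"
proof -
  have "verts_of F \<inter> P = (\<Union>S\<in>F. verts S \<inter> P)" by (auto simp: verts_of_def)
  also have "card \<dots> \<le> (\<Sum>S\<in>F. card (verts S \<inter> P))" using fin by (rule card_UN_le)
  also have "\<dots> \<le> (\<Sum>S\<in>F. 1)"
  proof (rule sum_mono)
    fix S assume "S \<in> F"
    then obtain u v where uv: "(u, v) \<in> parcs G" "verts S = {u, v}" using edge by blast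
    then have "verts S \<inter> P \<subseteq> {u} \<or> verts S \<inter> P \<subseteq> {v}"
      using indep[OF uv(1)] by auto
    then show "card (verts S \<inter> P) \<le> 1"
      using card_mono[of "{u}" "verts S \<inter> P"] card_mono[of "{v}" "verts S \<inter> P"] by auto
  qed
  finally show ?thesis by simp
qed

text \<open>The bound \<open>2 * m + 1\<close> is one less than twice the dimension. The dead
  classes satisfy the invariant, and quotient paths lift to the remaining vertices.\<close>

lemma connected_delete_edges:
  fixes F :: "(int list, int list \<times> int list) pre_digraph set"
  assumes m: "m \<ge> 1" and fin: "finite F" and card: "card F \<le> 2 * m + 1"
    and edge: "\<And>S. S \<in> F \<Longrightarrow> \<exists>u v. (u, v) \<in> parcs (BH (Suc m)) \<and> verts S = {u, v}"
  shows "connected (delete_verts (with_proj (BH (Suc m))) (verts_of F))"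
    and "\<not> trivial_graph (delete_verts (with_proj (BH (Suc m))) (verts_of F))"
proof -
  define X where "X = verts_of F"
  let ?H = "delete_verts (with_proj (BH (Suc m))) X"
  \<comment> \<open>A class is dead only if both of its members are deleted.\<close>
  define D where "D b = {xs \<in> bh_verts m. \<forall>a\<in>{0, 1, 2, 3}. odd a = b \<longrightarrow> a # xs \<in> X}" for b
  have sub: "D b \<subseteq> bh_verts m" for b by (auto simp: D_def)
  have finD: "finite (D b)" for b using sub finite_bh_verts finite_subset by blast
  have "finite (verts S)" if "S \<in> F" for S using edge[OF that] by auto
  then have finX: "finite X" using fin by (simp add: X_def verts_of_def)
  have twinsX: "twins b (D b) \<subseteq> X" for b by (auto simp: twins_def D_def)
  have count: "card P \<le> 2 * m + 1"
    if "P \<subseteq> X" "\<And>u v. (u, v) \<in> parcs (BH (Suc m)) \<Longrightarrow> u \<notin> P \<or> v \<notin> P" for P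
  proof -
    have "card (verts_of F \<inter> P) \<le> card F" using fin edge that(2) by (rule card_verts_of_Int)
    moreover have "verts_of F \<inter> P = P" using that(1) by (auto simp: X_def)
    ultimately show ?thesis using card by simp
  qed
  \<comment> \<open>The members of the dead classes of one side form an independent set, and
    \<open>2 * card (D b) \<le> 2 * m + 1\<close> rounds down to \<open>m\<close>.\<close>
  have cardD: "card (D b) \<le> m" for b
  proof -
    have "card (twins b (D b)) \<le> 2 * m + 1"
      using twinsX by (rule count) (auto simp: twins_def elim!: BH_arc_cases)
    then show ?thesis by (simp add: card_twins)
  qed
  have "qgood m D"
  proof (cases "\<exists>xs\<in>D False. \<exists>ys\<in>D True. ys \<in> qnbrs False xs")
    case True
    then show ?thesis using cardD by (simp add: qgood_def)
  next
    \<comment> \<open>Without dead edges the two sides together are still independent, so the total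
      is at most \<open>m\<close>, which is below \<open>2 * m\<close>.\<close>
    case False
    have "card (twins True (D True) \<union> twins False (D False)) \<le> 2 * m + 1"
    proof (rule count)
      fix u v assume "(u, v) \<in> parcs (BH (Suc m))"
      then obtain a xs c ys where *: "u = a # xs" "v = c # ys" "xs \<in> bh_verts m" "odd c \<noteq> odd a"
        "ys \<in> qnbrs (odd a) xs" by (elim BH_arc_cases) (auto simp: Cons_in_bh_verts)
      show "u \<notin> twins True (D True) \<union> twins False (D False) \<or>
        v \<notin> twins True (D True) \<union> twins False (D False)"
        using False * qnbrs_sym[OF *(3,5)] by (cases "odd a") (auto simp: twins_def)
    qed (use twinsX in blast)
    moreover have "card (twins True (D True) \<union> twins False (D False)) =
        card (twins True (D True)) + card (twins False (D False))"
      by (rule card_Un_disjoint) (auto simp: finite_twins finD, auto simp: twins_def)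
    ultimately have "card (D True) + card (D False) < 2 * m" using m by (simp add: card_twins)
    then show ?thesis using cardD by (simp add: qgood_def)
  qed
  then have conn: "qconn m D" using qconn_if_qgood m sub by blast
  have alive: "xs \<notin> D (odd a)" if "a # xs \<in> bh_verts (Suc m) - X" for a xs
  proof
    assume "xs \<in> D (odd a)"
    then have "\<forall>c\<in>{0, 1, 2, 3}. odd c = odd a \<longrightarrow> c # xs \<in> X" unfolding D_def by simp
    from bspec[OF this, of a] show False using that Cons_in_bh_verts[of a xs m] by simp
  qed
  have rep: "\<exists>a. odd a = b \<and> a # xs \<in> bh_verts (Suc m) - X" if "xs \<in> bh_verts m" "xs \<notin> D b" for b xs
  proof -
    have "\<not> (\<forall>a\<in>{0, 1, 2, 3}. odd a = b \<longrightarrow> a # xs \<in> X)" using that unfolding D_def by simp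
    then obtain a where "a \<in> {0, 1, 2, 3}" "odd a = b" "a # xs \<notin> X" by (meson ballI)
    then show ?thesis using that(1) Cons_in_bh_verts[of a xs m] by (intro exI[of _ a]) simp
  qed
  have vH: "verts ?H = bh_verts (Suc m) - X" by (simp add: delete_verts_def pverts_BH)
  have aH: "arcs_ends ?H = parcs (BH (Suc m)) \<inter> (verts ?H \<times> verts ?H)"
    by (auto simp: delete_verts_def arcs_ends_conv image_iff)
  define R where "R = rtrancl_on (verts ?H) ((arcs_ends ?H)\<^sup>s)"
  have stepR: "(u, w) \<in> R" if "(u, v) \<in> R" "(v, w) \<in> parcs (BH (Suc m))" "w \<in> verts ?H" for u v w
  proof -
    have "v \<in> verts ?H" using that(1) unfolding R_def by (rule in_rtrancl_on_in_F)
    then have "(v, w) \<in> (arcs_ends ?H)\<^sup>s" using that aH by (auto simp: symcl_def)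
    then show ?thesis using that unfolding R_def by (blast intro: rtrancl_on_into_rtrancl_on)
  qed
  have nbr: "\<exists>c ys. c # ys \<in> verts ?H \<and> odd c \<noteq> odd a \<and> ys \<in> qnbrs (odd a) xs"
    if "a # xs \<in> verts ?H" for a xs
  proof -
    have xs: "xs \<in> bh_verts m" using that vH by (simp add: Cons_in_bh_verts)
    then have "card (D (\<not> odd a)) \<le> length xs" using cardD[of "\<not> odd a"] by (simp add: bh_verts_def)
    then obtain ys where "ys \<in> qnbrs (odd a) xs" "ys \<notin> D (\<not> odd a)"
      using ex_qnbr_notin finD by blast
    then show ?thesis using rep[of ys "\<not> odd a"] qnbrs_in_bh_verts[OF xs] vH by metis
  qed
  have reach: "(u, v) \<in> R" if u: "u \<in> verts ?H" and v: "v \<in> verts ?H" for u v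
  proof -
    obtain a xs where a: "u = a # xs" "xs \<in> bh_verts m"
      using u vH by (auto elim: bh_verts_Suc_cases)
    obtain c ys where c: "v = c # ys" "ys \<in> bh_verts m"
      using v vH by (auto elim: bh_verts_Suc_cases)
    have uR: "(a # xs, a # xs) \<in> R" using u a by (simp add: R_def)
    \<comment> \<open>Quotient paths lift with an arbitrary surviving representative at the end.
      Even the empty path needs an argument: surviving twins are joined through a common live
      neighbour.\<close>
    have "(a # xs, c # ys) \<in> R" if "qlinked m D (odd a, xs) (b, ys)" "odd c = b" "c # ys \<in> verts ?H"
      for b c ys
      using that
    proof (induction arbitrary: c rule: rtrancl_induct2)
      case refl
      obtain e zs where e: "e # zs \<in> verts ?H" "odd e \<noteq> odd a" "zs \<in> qnbrs (odd a) xs"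
        using nbr u a by blast
      have arc: "(a # xs, e # zs) \<in> parcs (BH (Suc m))" "(c # xs, e # zs) \<in> parcs (BH (Suc m))"
        using e u a refl vH by (auto simp: BH_arc_iff)
      show ?case using stepR[OF stepR[OF uR arc(1) e(1)] BH_arc_sym[OF arc(2)] refl(2)] .
    next
      case (step b' xs' b ys')
      then have q: "xs' \<in> bh_verts m" "xs' \<notin> D b'" "b = (\<not> b')" "ys' \<in> qnbrs b' xs'"
        by (auto simp: qedges_def)
      obtain e where e: "odd e = b'" "e # xs' \<in> verts ?H" using rep[OF q(1,2)] vH by auto
      have "(e # xs', c # ys') \<in> parcs (BH (Suc m))"
        using e q step.prems vH by (auto simp: BH_arc_iff)
      then show ?case using stepR step.IH[OF e] step.prems by blast
    qed
    moreover have "qlinked m D (odd a, xs) (odd c, ys)"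
      using conn a c u v vH alive unfolding qconn_def by blast
    ultimately show ?thesis using a c v by blast
  qed
  \<comment> \<open>Connectedness includes being nonempty, and a second vertex excludes the trivial
    graph; a surviving vertex and a surviving neighbour provide both.\<close>
  have "card (D False) < 4 ^ m" using cardD[of False] two_mult_less_four_power[of m] by linarith
  then obtain xs where "xs \<in> bh_verts m" "xs \<notin> D False"
    using ex_bh_vert_notin finD by blast
  then obtain a where a: "a # xs \<in> verts ?H" using rep vH by metis
  then obtain c ys where c: "c # ys \<in> verts ?H" "odd c \<noteq> odd a" using nbr by blast
  have "connected ?H" using a reach unfolding connected_conv R_def by blast
  then show "connected (delete_verts (with_proj (BH (Suc m))) (verts_of F))" by (simp add: X_def)
  have "\<not> trivial_graph ?H"
  proof
    assume "trivial_graph ?H"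
    then obtain z where "verts ?H = {z}" by (auto simp: trivial_graph_def card_1_singleton_iff)
    then show False using a c by auto
  qed
  then show "\<not> trivial_graph (delete_verts (with_proj (BH (Suc m))) (verts_of F))"
    by (simp add: X_def)
qed

text \<open>The isomorphism yields two vertices and at least one arc. That arc belongs to the
  hypercube and is no loop, so its ends exhaust the vertices.\<close>

lemma iso_K11_edge:
  assumes sub: "subgraph S (with_proj (BH (Suc m)))" and iso: "digraph_iso S (with_proj K11)"
  shows "\<exists>u v. (u, v) \<in> parcs (BH (Suc m)) \<and> verts S = {u, v}"
proof -
  obtain f where f: "pre_digraph.digraph_isomorphism S f" "with_proj K11 = app_iso f S"
    using iso by (auto simp: digraph_iso_def)
  have "iso_verts f ` verts S = {0, 1}" using arg_cong[OF f(2), of verts] by (simp add: K11_def)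
  moreover have "inj_on (iso_verts f) (verts S)"
    using f(1) by (simp add: pre_digraph.digraph_isomorphism_def)
  ultimately have card: "card (verts S) = 2" using card_image[of "iso_verts f" "verts S"] by simp
  have "iso_arcs f ` arcs S = {(0, 1), (1, 0)}"
    using arg_cong[OF f(2), of arcs] by (simp add: K11_def)
  then obtain e where e: "e \<in> arcs S" by blast
  have wf: "wf_digraph S" using sub by (simp add: subgraph_def)
  have ends: "fst e \<in> verts S" "snd e \<in> verts S"
    using sub wf_digraph.tail_in_verts[OF wf e] wf_digraph.head_in_verts[OF wf e]
    by (auto simp: subgraph_def compatible_def)
  have arc: "(fst e, snd e) \<in> parcs (BH (Suc m))" using sub e by (auto simp: subgraph_def)
  then have "fst e \<noteq> snd e" by (rule BH_arc_cases) auto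
  moreover have "finite (verts S)" using card by (simp add: card_ge_0_finite)
  ultimately have "{fst e, snd e} = verts S"
    using ends card by (intro card_subset_eq) auto
  then show ?thesis using arc by metis
qed

section \<open>Upper bound: an explicit cut of at most \<open>2 * n\<close> edges\<close>

definition edge_graph :: "'a \<Rightarrow> 'a \<Rightarrow> 'a pair_pre_digraph" where
  "edge_graph u v = \<lparr>pverts = {u, v}, parcs = {(u, v), (v, u)}\<rparr>"

lemma edge_graph_simps:
  "pverts (edge_graph u v) = {u, v}" "parcs (edge_graph u v) = {(u, v), (v, u)}"
  by (simp_all add: edge_graph_def)

lemma pair_graph_edge_graph: "u \<noteq> v \<Longrightarrow> pair_graph (edge_graph u v)"
  by unfold_locales (auto simp: edge_graph_simps symmetric_def intro!: symI)

lemma connected_edge_graph: "connected (with_proj (edge_graph u v))"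
  unfolding connected_conv
  by (auto simp: edge_graph_simps symcl_def intro: converse_rtrancl_on_into_rtrancl_on)

lemma edge_graph_iso_K11:
  assumes "u \<noteq> v"
  shows "digraph_iso (with_proj (edge_graph u v)) (with_proj K11)"
proof -
  let ?f = "\<lambda>x. if x = u then 0 else 1 :: nat"
  let ?h = "\<lparr>iso_verts = ?f, iso_arcs = map_prod ?f ?f, iso_head = snd, iso_tail = fst\<rparr>"
  have "wf_digraph (with_proj (edge_graph u v))"
    using pair_graph_edge_graph[OF assms] graph.axioms pair_graph.pair_graphD_graph
    by (metis digraph.axioms(1) fin_digraph.axioms(1))
  then have "pre_digraph.digraph_isomorphism (with_proj (edge_graph u v)) ?h"
    using assms unfolding pre_digraph.digraph_isomorphism_def
    by (auto simp: edge_graph_simps inj_on_def)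
  moreover have "with_proj K11 = app_iso ?h (with_proj (edge_graph u v))"
    using assms by (auto simp: app_iso_def with_proj_def K11_def edge_graph_def)
  ultimately show ?thesis unfolding digraph_iso_def by blast
qed

lemma connected_subgraph_edge_graph:
  assumes "(u, v) \<in> parcs (BH (Suc m))"
  shows "connected_subgraph (with_proj (edge_graph u v)) (with_proj (BH (Suc m)))"
proof -
  have neq: "u \<noteq> v" using assms by (auto elim: BH_arc_cases)
  have g: "graph (with_proj (edge_graph u v))" "graph (with_proj (BH (Suc m)))"
    using pair_graph_edge_graph[OF neq] pair_graph_BH pair_graph.pair_graphD_graph by blast+
  then have "wf_digraph (with_proj (edge_graph u v))" "wf_digraph (with_proj (BH (Suc m)))"
    by (auto dest: graph.axioms digraph.axioms fin_digraph.axioms)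
  moreover have "u \<in> bh_verts (Suc m)" "v \<in> bh_verts (Suc m)"
    using assms by (auto elim: BH_arc_cases)
  ultimately have "subgraph (with_proj (edge_graph u v)) (with_proj (BH (Suc m)))"
    using assms BH_arc_sym[OF assms]
    by (auto simp: subgraph_def edge_graph_simps pverts_BH)
  then show ?thesis using g connected_edge_graph by (simp add: connected_subgraph_def)
qed

lemma structure_cut_exists:
  assumes m: "m \<ge> 1"
  shows "\<exists>F. finite F \<and> structure_cut (with_proj (BH (Suc m))) (with_proj K11) F \<and>
    card F \<le> 2 * Suc m"
proof -
  \<comment> \<open>The vertex to be isolated is \<open>0 # z\<close>; its twin \<open>2 # z\<close>
    survives and witnesses disconnectedness.\<close>
  define z where "z = replicate m (0 :: int)"
  have z: "z \<in> bh_verts m" by (auto simp: z_def bh_verts_def)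
  \<comment> \<open>Since \<open>m \<ge> 1\<close>, each neighbour class has at least two
    neighbours, hence one other than the class of \<open>0 # z\<close>.\<close>
  have "\<forall>ys\<in>qnbrs False z. \<exists>zs. zs \<in> qnbrs True ys \<and> zs \<noteq> z"
  proof
    fix ys assume "ys \<in> qnbrs False z"
    then have "length ys = m" using qnbrs_in_bh_verts[OF z] by (simp add: bh_verts_def)
    then obtain zs where "zs \<in> qnbrs True ys" "zs \<notin> {z}"
      using ex_qnbr_notin[of "{z}" ys True] m by auto
    then show "\<exists>zs. zs \<in> qnbrs True ys \<and> zs \<noteq> z" by blast
  qed
  then obtain g where g: "\<And>ys. ys \<in> qnbrs False z \<Longrightarrow> g ys \<in> qnbrs True ys \<and> g ys \<noteq> z" by metis
  \<comment> \<open>For \<open>c\<close> in \<open>{1, 3}\<close>, \<open>c # ys\<close> runs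
    through the neighbours of \<open>0 # z\<close>. The other end avoids \<open>0 # z\<close> by its
    tail and \<open>2 # z\<close> by its head.\<close>
  define E where "E = (\<lambda>(c, ys). with_proj (edge_graph (c # ys) ((0 :: int) # g ys)))"
  define F where "F = E ` ({1, 3} \<times> qnbrs False z)"
  have fin: "finite F" by (simp add: F_def finite_qnbrs)
  have "card F \<le> card ({1, 3 :: int} \<times> qnbrs False z)"
    unfolding F_def by (rule card_image_le) (simp add: finite_qnbrs)
  also have "\<dots> = 2 * Suc m"
    by (simp add: card_cartesian_product card_qnbrs z_def)
  finally have card: "card F \<le> 2 * Suc m" .
  have arc: "(c # ys, 0 # g ys) \<in> parcs (BH (Suc m))" if "c \<in> {1, 3}" "ys \<in> qnbrs False z" for c ys
  proof -
    have ys: "ys \<in> bh_verts m" using qnbrs_in_bh_verts[OF z that(2)] .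
    then have "g ys \<in> bh_verts m" using qnbrs_in_bh_verts g[OF that(2)] by blast
    then show ?thesis using that ys g[OF that(2)] by (auto simp: BH_arc_iff Cons_in_bh_verts)
  qed
  have F: "connected_subgraph S (with_proj (BH (Suc m))) \<and> digraph_iso S (with_proj K11)"
    if SF: "S \<in> F" for S
  proof -
    obtain c ys where S: "c \<in> {1, 3}" "ys \<in> qnbrs False z"
      "S = with_proj (edge_graph (c # ys) (0 # g ys))"
      using SF by (auto simp: F_def E_def)
    have "c # ys \<noteq> 0 # g ys" using S(1) by auto
    from edge_graph_iso_K11[OF this] show ?thesis
      using S(3) connected_subgraph_edge_graph[OF arc[OF S(1,2)]] by simp
  qed
  let ?X = "verts_of F"
  let ?H = "delete_verts (with_proj (BH (Suc m))) ?X"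
  have X: "?X = (\<Union>c\<in>{1, 3}. \<Union>ys\<in>qnbrs False z. {c # ys, 0 # g ys})"
    by (auto simp: verts_of_def F_def E_def edge_graph_simps)
  have vH: "verts ?H = bh_verts (Suc m) - ?X" by (simp add: delete_verts_def pverts_BH)
  have notin_X: "0 # z \<notin> ?X" "2 # z \<notin> ?X" unfolding X using g by auto
  have in_H: "0 # z \<in> verts ?H" "2 # z \<in> verts ?H"
    using z notin_X by (auto simp: vH Cons_in_bh_verts)
  have isolated: False if "(0 # z, w) \<in> (arcs_ends ?H)\<^sup>s" for w
  proof -
    have w: "(0 # z, w) \<in> parcs (BH (Suc m))" "w \<in> verts ?H"
      using that BH_arc_sym by (auto simp: symcl_def delete_verts_def arcs_ends_conv)
    from w(1) obtain c ys where "w = c # ys" "c # ys \<in> bh_verts (Suc m)" "odd c"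
      "ys \<in> qnbrs False z"
      by (rule BH_arc_cases) auto
    moreover from this have "c \<in> {1, 3}" by (auto simp: Cons_in_bh_verts)
    ultimately have "w \<in> ?X" unfolding X by blast
    then show False using w(2) vH by blast
  qed
  have "\<not> connected ?H"
  proof
    assume "connected ?H"
    then have "(0 # z, 2 # z) \<in> rtrancl_on (verts ?H) ((arcs_ends ?H)\<^sup>s)"
      using in_H unfolding connected_conv by blast
    then show False using isolated by (cases rule: converse_rtrancl_on_cases) auto
  qed
  then have "structure_cut (with_proj (BH (Suc m))) (with_proj K11) F"
    using F by (simp add: structure_cut_def subgraph_cut_def)
  then show ?thesis using fin card by blast
qed

theorem theorem3:
  fixes n :: nat
  assumes "n \<ge> 2"
  shows "structure_connectivity (with_proj (BH n)) (with_proj K11) = 2 * n"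
proof -
  obtain m where n: "n = Suc m" and m: "m \<ge> 1" using assms by (cases n) auto
  let ?C = "{card F | F. finite F \<and> structure_cut (with_proj (BH n)) (with_proj K11) F}"
  \<comment> \<open>Fewer than \<open>2 * n = 2 * m + 2\<close> edges means at most
    \<open>2 * m + 1\<close>, the bound of \<open>connected_delete_edges\<close>.\<close>
  have lower: "2 * n \<le> k" if k: "k \<in> ?C" for k
  proof (rule ccontr)
    assume "\<not> 2 * n \<le> k"
    obtain F where F: "k = card F" "finite F"
      "structure_cut (with_proj (BH (Suc m))) (with_proj K11) F"
      using k unfolding n by blast
    have "card F \<le> 2 * m + 1" using \<open>\<not> 2 * n \<le> k\<close> F(1) n by simp
    moreover have "\<exists>u v. (u, v) \<in> parcs (BH (Suc m)) \<and> verts S = {u, v}" if "S \<in> F" for S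
      using F(3) that iso_K11_edge
      by (auto simp: structure_cut_def subgraph_cut_def connected_subgraph_def)
    ultimately show False
      using connected_delete_edges[OF m F(2)] F(3)
      by (simp add: structure_cut_def subgraph_cut_def)
  qed
  obtain F where F: "finite F" "structure_cut (with_proj (BH n)) (with_proj K11) F" "card F \<le> 2 * n"
    using structure_cut_exists[OF m] n by blast
  \<comment> \<open>An actual cut makes \<open>?C\<close> nonempty, as the lower bound on its
    infimum requires, and gives the upper bound.\<close>
  then have mem: "card F \<in> ?C" by blast
  have "Inf ?C \<le> 2 * n" using cInf_lower[OF mem] F(3) by simp
  moreover have "2 * n \<le> Inf ?C" using mem lower by (intro cInf_greatest) auto
  ultimately show ?thesis by (simp add: structure_connectivity_def)
qed

end
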